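(* Let $L\ge 2$ be an integer and let $P,N>0$ satisfy $N\le \frac{L-1}{L}P$. Then the $(P,N,L-1)$-list-decoding capacity satisfies $$C_{L-1}(P,N)\;\ge\;\frac12\left[\ln\frac{(L-1)P}{LN}+\frac{1}{L-1}\ln\frac{P}{L(P-N)}\right].$$
   Context: For $r>0$, $\mathcal{B}^n(r)$ is the closed Euclidean ball of radius $r$ centered at the origin of $\mathbb{R}^n$. For points $x_1,\dots,x_L\in\mathbb{R}^n$, the squared Chebyshev radius is $\mathrm{rad}^2(x_1,\dots,x_L)=\min_{y\in\mathbb{R}^n}\max_{1\le i\le L}\|x_i-y\|_2^2$ (the squared radius of the smallest ball containing the points). For a finite set (code) $\mathcal{C}\subset\mathbb{R}^n$, $\mathrm{rad}^2_L(\mathcal{C})=\min\{\mathrm{rad}^2(\mathcal{L}):\mathcal{L}\subset\mathcal{C},\ |\mathcal{L}|=L\}$, and the rate is $R(\mathcal{C})=\frac1n\ln|\mathcal{C}|$. The condition $\mathrm{rad}^2_L(\mathcal{C})>nN$ is equivalent to: every $y\in\mathbb{R}^n$ is within distance $\sqrt{nN}$ of at most $L-1$ points of $\mathcal{C}$ (i.e. $\mathcal{C}$ is $(L-1)$-list-decodable). The $(P,N,L-1)$-list-decoding capacity is $$C_{L-1}(P,N)=\limsup_{n\to\infty}\ \sup\{R(\mathcal{C}):\ \mathcal{C}\subseteq\mathcal{B}^n(\sqrt{nP}),\ \mathrm{rad}^2_L(\mathcal{C})>nN\}.$$ *)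

theory Defs
  imports "HOL-Analysis.Analysis"
begin

text \<open>
  The dimension varies inside the capacity, so the points of \<open>n\<close>-dimensional Euclidean space are
  functions on \<open>{..<n}\<close>. They are taken extensional, so that equality of points is equality of
  coordinates and \<open>card\<close> counts points; this set is also the space of the product measure
  \<open>PiM {..<n} (\<lambda>_. lborel)\<close>.
\<close>

definition Rn :: "nat \<Rightarrow> (nat \<Rightarrow> real) set" where
  "Rn n = {..<n} \<rightarrow>\<^sub>E UNIV"

definition dist_Rn :: "nat \<Rightarrow> (nat \<Rightarrow> real) \<Rightarrow> (nat \<Rightarrow> real) \<Rightarrow> real" where
  "dist_Rn n x y = L2_set (\<lambda>i. x i - y i) {..<n}"

definition ball_Rn :: "nat \<Rightarrow> real \<Rightarrow> (nat \<Rightarrow> real) set" where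
  "ball_Rn n r = {x \<in> Rn n. L2_set x {..<n} \<le> r}"

text \<open>Meant for finite nonempty \<open>A \<subseteq> Rn n\<close>; the infimum is then attained.\<close>

definition chebyshev_rad2 :: "nat \<Rightarrow> (nat \<Rightarrow> real) set \<Rightarrow> real" where
  "chebyshev_rad2 n A = (INF y\<in>Rn n. MAX x\<in>A. (dist_Rn n x y)\<^sup>2)"

text \<open>
  Extended-real valued: a code with fewer than \<open>L\<close> points has radius \<open>\<infinity>\<close>, in accordance with such
  a code being trivially \<open>(L - 1)\<close>-list-decodable. For a finite code this is an infimum over
  finitely many sets.
\<close>

definition code_rad2 :: "nat \<Rightarrow> nat \<Rightarrow> (nat \<Rightarrow> real) set \<Rightarrow> ereal" where
  "code_rad2 n L C = (INF A\<in>{A. A \<subseteq> C \<and> card A = L}. ereal (chebyshev_rad2 n A))"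

definition rate :: "nat \<Rightarrow> (nat \<Rightarrow> real) set \<Rightarrow> real" where
  "rate n C = ln (real (card C)) / real n"

text \<open>
  The last argument \<open>l\<close> is the list size, so the relevant radius is that of \<open>(l + 1)\<close>-point subsets.
  Codes are nonempty, which avoids the convention \<open>ln 0 = 0\<close>.
\<close>

definition list_decodable_codes ::
    "nat \<Rightarrow> real \<Rightarrow> real \<Rightarrow> nat \<Rightarrow> (nat \<Rightarrow> real) set set" where
  "list_decodable_codes n P N l =
     {C. finite C \<and> C \<noteq> {} \<and> C \<subseteq> ball_Rn n (sqrt (real n * P)) \<and>
         code_rad2 n (l + 1) C > ereal (real n * N)}"

definition list_decoding_capacity :: "real \<Rightarrow> real \<Rightarrow> nat \<Rightarrow> ereal" where
  "list_decoding_capacity P N l =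
     limsup (\<lambda>n. SUP C\<in>list_decodable_codes n P N l. ereal (rate n C))"

end

theory Submission
  imports Defs "HOL-Probability.Distributions" "HOL-Real_Asymp.Real_Asymp"
begin

text \<open>
  The codes come from the probabilistic method with expurgation. Draw \<open>M\<close> independent uniform points
  in the ball of squared radius \<open>n P\<close>. If \<open>L\<close> points lie in a ball of squared radius \<open>n N\<close>, their mean
  squared distance to the centroid is also at most \<open>n N\<close> (\<open>inertia_le_chebyshev_rad2\<close>). It therefore
  suffices to avoid \<open>L\<close>-tuples of low inertia. If such a tuple occurs with probability \<open>p\<close> and
  \<open>M ^ (L - 1) * p < 1 / 2\<close>, then on average fewer than \<open>M / 2\<close> bad tuples occur, and removing one point
  of each leaves a good code (\<open>exists_large_good_subset\<close>, \<open>code_of_high_inertia\<close>). So the capacity is at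
  least \<open>1 / (L - 1)\<close> times the exponential decay rate of \<open>p\<close>.

  Replacing the Chebyshev radius by the mean squared distance makes the event quadratic, and a
  Chernoff bound with a Gaussian weight can be evaluated in closed form
  (\<open>emeasure_low_inertia_le\<close>). With the optimal multipliers and the asymptotics of the volume of the
  ball (\<open>ball_volume_even_ge\<close>), the bound is, up to a polynomial factor,
  \<open>p \<le> (l1 * l2 ^ (L - 1) / P ^ L) ^ (n / 2)\<close> with \<open>l1 = L * (P - N)\<close> and \<open>l2 = L * N / (L - 1)\<close>
  (\<open>emeasure_low_inertia_exponent\<close>). The two factors \<open>(P / l2) ^ (L - 1)\<close> and \<open>P / l1\<close> of the inverse
  of the base yield the two logarithms of the theorem.
\<close>

section \<open>Inertia and the Chebyshev radius\<close>

text \<open>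
  The moment of inertia of unit masses about their centroid. The points form a family, not a set:
  it becomes a random variable on a product space, and repeated points count with multiplicity.
\<close>

definition inertia :: "nat \<Rightarrow> 'i set \<Rightarrow> ('i \<Rightarrow> nat \<Rightarrow> real) \<Rightarrow> real" where
  "inertia n S x = (\<Sum>k<n. \<Sum>j\<in>S. (x j k - (\<Sum>i\<in>S. x i k) / card S)\<^sup>2)"

lemma sum_sq_dist_eq_inertia:
  assumes "finite S" "S \<noteq> {}"
  shows "(\<Sum>j\<in>S. \<Sum>k<n. (x j k - y k)\<^sup>2) =
         inertia n S x + card S * (\<Sum>k<n. (y k - (\<Sum>i\<in>S. x i k) / card S)\<^sup>2)"
proof -
  have c: "real (card S) \<noteq> 0" using assms by simp
  have 1: "(\<Sum>j\<in>S. (x j k - y k)\<^sup>2) = (\<Sum>j\<in>S. (x j k - m)\<^sup>2) + card S * (y k - m)\<^sup>2"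
    if m: "m = (\<Sum>i\<in>S. x i k) / card S" for k m
  proof -
    have mm: "(\<Sum>i\<in>S. x i k) = card S * m" using m c by (simp add: field_simps)
    have "(\<Sum>j\<in>S. (x j k - y k)\<^sup>2) = (\<Sum>j\<in>S. (x j k - m)\<^sup>2 + 2 * (m - y k) * (x j k - m) + (y k - m)\<^sup>2)"
      by (intro sum.cong) (auto simp: power2_eq_square algebra_simps)
    also have "\<dots> = (\<Sum>j\<in>S. (x j k - m)\<^sup>2) + 2 * (m - y k) * (\<Sum>j\<in>S. x j k - m) + card S * (y k - m)\<^sup>2"
      by (simp add: sum.distrib sum_distrib_left)
    also have "(\<Sum>j\<in>S. x j k - m) = 0" by (simp add: sum_subtractf mm)
    finally show ?thesis by simp
  qed
  show ?thesis
    unfolding inertia_def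
    by (subst sum.swap) (simp add: 1[OF refl] sum.distrib sum_distrib_left)
qed

lemma inertia_le_sum_sq_dist:
  assumes "finite S"
  shows "inertia n S x \<le> (\<Sum>j\<in>S. \<Sum>k<n. (x j k - y k)\<^sup>2)"
proof (cases "S = {}")
  case False
  show ?thesis unfolding sum_sq_dist_eq_inertia[OF assms False] by (simp add: sum_nonneg)
qed (simp add: inertia_def)

text \<open>
  A maximum dominates a mean, and the mean squared distance to a centre is least at the
  centroid. So the squared Chebyshev radius is at least the average squared radius; the latter is a
  quadratic form in the points, which makes Gaussian integration applicable.
\<close>

lemma inertia_le_chebyshev_rad2:
  assumes "finite S" "S \<noteq> {}" "inj_on x S"
  shows "inertia n S x / card S \<le> chebyshev_rad2 n (x ` S)"
  unfolding chebyshev_rad2_def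
proof (rule cINF_greatest)
  show "Rn n \<noteq> {}" by (auto simp: Rn_def PiE_eq_empty_iff)
  fix y assume "y \<in> Rn n"
  let ?m = "MAX a\<in>x ` S. (dist_Rn n a y)\<^sup>2"
  have d: "(dist_Rn n a y)\<^sup>2 = (\<Sum>k<n. (a k - y k)\<^sup>2)" for a
    unfolding dist_Rn_def L2_set_def by (simp add: sum_nonneg)
  have "inertia n S x \<le> (\<Sum>j\<in>S. \<Sum>k<n. (x j k - y k)\<^sup>2)"
    by (rule inertia_le_sum_sq_dist) fact
  also have "\<dots> \<le> (\<Sum>j\<in>S. ?m)"
    unfolding d[symmetric] by (intro sum_mono Max_ge) (use assms in auto)
  finally show "inertia n S x / card S \<le> ?m"
    using assms by (simp add: field_simps card_gt_0_iff)
qed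

lemma inertia_cong: "(\<And>j. j \<in> S \<Longrightarrow> x j = y j) \<Longrightarrow> inertia n S x = inertia n S y"
  by (simp add: inertia_def cong: sum.cong)

lemma inertia_const: "inertia n S (\<lambda>_. c) = 0"
  by (cases "finite S \<and> S \<noteq> {}") (auto simp: inertia_def)

section \<open>Gaussian integrals and the volume of balls\<close>

lemma nn_integral_gaussian:
  assumes "a > 0"
  shows "(\<integral>\<^sup>+x. ennreal (exp (- a * (x - m)\<^sup>2)) \<partial>lborel) = ennreal (sqrt (pi / a))"
proof -
  define \<sigma> where "\<sigma> = sqrt (1 / (2 * a))"
  have \<sigma>: "\<sigma> > 0" "\<sigma>\<^sup>2 = 1 / (2 * a)" using assms by (auto simp: \<sigma>_def)
  have e: "exp (- a * (x - m)\<^sup>2) = sqrt (pi / a) * normal_density m \<sigma> x" for x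
    unfolding normal_density_def \<sigma>(2) using assms by (simp add: field_simps)
  interpret prob_space "density lborel (normal_density m \<sigma>)"
    by (rule prob_space_normal_density) fact
  have "(\<integral>\<^sup>+x. ennreal (normal_density m \<sigma> x) \<partial>lborel) = 1"
    using emeasure_space_1 by (simp add: emeasure_density)
  then show ?thesis
    unfolding e using assms by (simp add: ennreal_mult nn_integral_cmult)
qed

abbreviation lborel_Rn :: "nat \<Rightarrow> (nat \<Rightarrow> real) measure" where
  "lborel_Rn n \<equiv> Pi\<^sub>M {..<n} (\<lambda>_. lborel)"

lemma nn_integral_gaussian_Rn:
  assumes "a > 0"
  shows "(\<integral>\<^sup>+y. ennreal (exp (- a * (\<Sum>k<n. (y k - m k)\<^sup>2))) \<partial>lborel_Rn n) = ennreal (sqrt (pi / a) ^ n)"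
proof -
  interpret product_sigma_finite "\<lambda>_::nat. lborel :: real measure" by standard
  have "(\<integral>\<^sup>+y. ennreal (exp (- a * (\<Sum>k<n. (y k - m k)\<^sup>2))) \<partial>lborel_Rn n)
      = (\<integral>\<^sup>+y. (\<Prod>k<n. ennreal (exp (- a * (y k - m k)\<^sup>2))) \<partial>lborel_Rn n)"
    by (intro nn_integral_cong) (simp add: prod_ennreal sum_distrib_left exp_sum)
  also have "\<dots> = (\<Prod>k<n. \<integral>\<^sup>+y. ennreal (exp (- a * (y - m k)\<^sup>2)) \<partial>lborel)"
    by (rule product_nn_integral_prod) auto
  also have "\<dots> = ennreal (sqrt (pi / a) ^ n)"
    unfolding nn_integral_gaussian[OF assms] using assms by (simp add: ennreal_power)
  finally show ?thesis .
qed

text \<open>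
  Completing the square in each coordinate:
  \<open>t u\<^sup>2 + s (u - w)\<^sup>2 = (t + s) (u - s w / (t + s))\<^sup>2 + t s / (t + s) w\<^sup>2\<close>.
\<close>

lemma nn_integral_two_gaussians_Rn:
  assumes "t > 0" "s > 0"
  shows "(\<integral>\<^sup>+x. ennreal (exp (- t * (\<Sum>k<n. (x k)\<^sup>2) - s * (\<Sum>k<n. (x k - y k)\<^sup>2))) \<partial>lborel_Rn n)
       = ennreal (sqrt (pi / (t + s)) ^ n * exp (- (t * s / (t + s)) * (\<Sum>k<n. (y k)\<^sup>2)))"
proof -
  have c: "t * u\<^sup>2 + s * (u - w)\<^sup>2 = (t + s) * (u - s * w / (t + s))\<^sup>2 + t * s / (t + s) * w\<^sup>2" for u w
    using assms add_pos_pos[OF assms] by (simp add: divide_simps) algebra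
  have e: "- t * (\<Sum>k<n. (x k)\<^sup>2) - s * (\<Sum>k<n. (x k - y k)\<^sup>2)
     = - (t * s / (t + s)) * (\<Sum>k<n. (y k)\<^sup>2) + - (t + s) * (\<Sum>k<n. (x k - s * y k / (t + s))\<^sup>2)" for x
  proof -
    have "t * (\<Sum>k<n. (x k)\<^sup>2) + s * (\<Sum>k<n. (x k - y k)\<^sup>2)
      = (\<Sum>k<n. t * (x k)\<^sup>2 + s * (x k - y k)\<^sup>2)" by (simp add: sum.distrib sum_distrib_left)
    also have "\<dots> = (t + s) * (\<Sum>k<n. (x k - s * y k / (t + s))\<^sup>2) + t * s / (t + s) * (\<Sum>k<n. (y k)\<^sup>2)"
      unfolding c by (simp add: sum.distrib sum_distrib_left)
    finally show ?thesis unfolding mult_minus_left by linarith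
  qed
  show ?thesis
    unfolding e exp_add using assms
    by (simp only: ennreal_mult exp_ge_zero add_pos_pos nn_integral_gaussian_Rn)
       (subst nn_integral_cmult, measurable,
        simp only: ennreal_mult[symmetric] add_pos_pos nn_integral_gaussian_Rn, simp add: ennreal_mult mult.commute)
qed

lemma emeasure_ball_Rn:
  assumes "r > 0"
  shows "ball_Rn n r \<in> sets (lborel_Rn n)"
    and "emeasure (lborel_Rn n) (ball_Rn n r) = ennreal (unit_ball_vol (real n) * r ^ n)"
proof -
  have e: "ball_Rn n r = {f. sqrt (\<Sum>i\<in>{..<n}. (f i)\<^sup>2) \<le> r} \<inter> space (lborel_Rn n)"
    by (auto simp: ball_Rn_def L2_set_def space_PiM Rn_def)
  show "emeasure (lborel_Rn n) (ball_Rn n r) = ennreal (unit_ball_vol (real n) * r ^ n)"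
    unfolding e using assms by (subst emeasure_cball_aux) auto
  have "{x\<in>space (lborel_Rn n). sqrt (\<Sum>i\<in>{..<n}. (x i)\<^sup>2) \<le> r} \<in> sets (lborel_Rn n)"
    by measurable
  also have "{x\<in>space (lborel_Rn n). sqrt (\<Sum>i\<in>{..<n}. (x i)\<^sup>2) \<le> r} = ball_Rn n r"
    unfolding e by auto
  finally show "ball_Rn n r \<in> sets (lborel_Rn n)" .
qed

text \<open>
  A weak Stirling bound, off by a factor linear in \<open>m\<close>; the rate only sees exponential growth.
  The induction step is \<open>e \<le> (1 + 1 / m) ^ (m + 1)\<close>.
\<close>

lemma fact_exp_le: "m \<ge> 1 \<Longrightarrow> fact m * exp (real m) \<le> real m ^ (m + 1) * exp 1"
proof (induction m rule: nat_induct_at_least)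
  case (Suc m)
  have "real m / real (m + 1) \<le> exp (- (1 / real (m + 1)))"
    using exp_ge_add_one_self[of "- (1 / real (m + 1))"] by (simp add: field_simps)
  then have "(real m / real (m + 1)) ^ (m + 1) \<le> exp (- (1 / real (m + 1))) ^ (m + 1)"
    by (intro power_mono) auto
  also have "\<dots> = exp (real (m + 1) * (- (1 / real (m + 1))))"
    by (rule exp_of_nat_mult[symmetric])
  also have "real (m + 1) * (- (1 / real (m + 1))) = - 1" by simp
  finally have *: "real m ^ (m + 1) * exp 1 \<le> real (m + 1) ^ (m + 1)"
    by (simp add: power_divide divide_simps exp_minus)
  have "fact (Suc m) * exp (real (Suc m)) = real (m + 1) * exp 1 * (fact m * exp (real m))"
    by (simp add: exp_add algebra_simps)
  also have "\<dots> \<le> real (m + 1) * exp 1 * (real m ^ (m + 1) * exp 1)"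
    using Suc by (intro mult_left_mono) auto
  also have "\<dots> \<le> real (m + 1) * exp 1 * real (m + 1) ^ (m + 1)"
    using * by (intro mult_left_mono) auto
  finally show ?case by (simp add: algebra_simps)
qed simp

text \<open>
  Even dimensions suffice, since the capacity is an upper limit over all dimensions; there the
  volume involves a factorial instead of the Gamma function.
\<close>

lemma ball_volume_even_ge:
  assumes "m \<ge> 1" "P > 0"
  shows "unit_ball_vol (real (2 * m)) * sqrt (real (2 * m) * P) ^ (2 * m)
    \<ge> (2 * pi * exp 1 * P) ^ m / (exp 1 * real m)"
proof -
  have "sqrt (real (2 * m) * P) ^ (2 * m) = (real (2 * m) * P) ^ m"
    using assms by (simp add: power_mult)
  then have v: "unit_ball_vol (real (2 * m)) * sqrt (real (2 * m) * P) ^ (2 * m)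
      = (2 * pi * P) ^ m * (real m ^ m / fact m)"
    unfolding unit_ball_vol_even by (simp add: power_mult_distrib field_simps)
  have "fact m * exp (real m) \<le> real m ^ m * (exp 1 * real m)"
    using fact_exp_le[OF assms(1)] by (simp add: mult_ac)
  then have "exp 1 ^ m / (exp 1 * real m) \<le> real m ^ m / fact m"
    using assms by (simp add: field_simps flip: exp_of_nat_mult)
  then have "(2 * pi * P) ^ m * (exp 1 ^ m / (exp 1 * real m)) \<le> (2 * pi * P) ^ m * (real m ^ m / fact m)"
    using assms by (intro mult_left_mono) auto
  then show ?thesis unfolding v by (simp add: power_mult_distrib mult_ac)
qed

section \<open>The probability that a random tuple has low inertia\<close>

text \<open>
  The underlying space is cut down to \<open>B\<close> itself, so every sample point lies in \<open>B\<close>, not merely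
  almost every one; no null sets have to be removed from the random code.
\<close>

definition uniform_on :: "'a measure \<Rightarrow> 'a set \<Rightarrow> 'a measure" where
  "uniform_on V B = scale_measure (1 / emeasure V B) (restrict_space V B)"

lemma space_uniform_on: "B \<in> sets V \<Longrightarrow> space (uniform_on V B) = B"
  using sets.sets_into_space[of B V] by (auto simp: uniform_on_def space_restrict_space space_scale_measure)

lemma prob_space_uniform_on:
  assumes "B \<in> sets V" "emeasure V B \<noteq> 0" "emeasure V B \<noteq> \<infinity>"
  shows "prob_space (uniform_on V B)"
proof
  show "emeasure (uniform_on V B) (space (uniform_on V B)) = 1"
    unfolding space_uniform_on[OF assms(1)] using assms
    by (simp add: uniform_on_def emeasure_restrict_space ennreal_divide_times ennreal_divide_self less_top)
qed

lemma nn_integral_uniform_on_le: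
  assumes "B \<in> sets V" "f \<in> borel_measurable V"
  shows "(\<integral>\<^sup>+x. f x \<partial>uniform_on V B) \<le> 1 / emeasure V B * (\<integral>\<^sup>+x. f x \<partial>V)"
proof -
  have "(\<integral>\<^sup>+x. f x \<partial>uniform_on V B) = 1 / emeasure V B * (\<integral>\<^sup>+x. f x * indicator B x \<partial>V)"
    unfolding uniform_on_def using assms
    by (subst nn_integral_scale_measure)
       (auto simp: nn_integral_restrict_space intro!: measurable_restrict_space1)
  also have "\<dots> \<le> 1 / emeasure V B * (\<integral>\<^sup>+x. f x \<partial>V)"
    by (intro mult_left_mono nn_integral_mono) (auto simp: indicator_def)
  finally show ?thesis .
qed

lemma measurable_uniform_on:
  "f \<in> measurable V N \<Longrightarrow> f \<in> measurable (uniform_on V B) N"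
  unfolding uniform_on_def by (simp add: measurable_restrict_space1 cong: measurable_cong_sets)

lemma measurable_inertia:
  assumes "finite S"
  shows "inertia n S \<in> borel_measurable (Pi\<^sub>M S (\<lambda>_. uniform_on (lborel_Rn n) B))"
proof -
  let ?U = "uniform_on (lborel_Rn n) B"
  have c: "(\<lambda>x. x j k) \<in> borel_measurable (Pi\<^sub>M S (\<lambda>_. ?U))" if "j \<in> S" "k < n" for j k
  proof -
    have "(\<lambda>y. y k) \<in> borel_measurable ?U"
      using that by (intro measurable_uniform_on) measurable
    from measurable_compose[OF measurable_component_singleton[OF that(1)] this] show ?thesis by simp
  qed
  show ?thesis
    unfolding inertia_def
    by (intro borel_measurable_sum borel_measurable_power borel_measurable_diff borel_measurable_divide) (auto intro: c)
qed

text \<open>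
  A Chernoff bound with two multipliers, \<open>t\<close> for the power constraints \<open>\<parallel>x j\<parallel>\<^sup>2 \<le> r\<^sup>2\<close> and \<open>s\<close> for
  the constraint \<open>inertia n S x \<le> c\<close>. The weight \<open>exp (- s * inertia n S x)\<close> couples the points. It
  is decoupled by writing it as a multiple of \<open>\<integral> exp (- s * (\<Sum>j\<in>S. \<parallel>x j - y\<parallel>\<^sup>2)) dy\<close>, which is possible
  because the sum splits into the inertia and \<open>card S\<close> times the squared distance from \<open>y\<close> to the
  centroid. For fixed \<open>y\<close> the integrand is then a product over the points, and what remains are
  Gaussian integrals.
\<close>

lemma emeasure_low_inertia_le:
  fixes S :: "'i set" and n :: nat and r t s c :: real
  defines "v \<equiv> unit_ball_vol (real n) * r ^ n" and "U \<equiv> uniform_on (lborel_Rn n) (ball_Rn n r)"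
    and "L \<equiv> real (card S)"
  assumes S: "finite S" "S \<noteq> {}" and r: "r > 0" and t: "t > 0" and s: "s > 0"
  shows "emeasure (Pi\<^sub>M S (\<lambda>_. U)) {x \<in> space (Pi\<^sub>M S (\<lambda>_. U)). inertia n S x \<le> c}
    \<le> ennreal (exp (t * L * r\<^sup>2 + s * c) * sqrt (s * L / pi) ^ n *
         (sqrt (pi / (t + s)) ^ n / v) ^ card S * sqrt (pi * (t + s) / (L * t * s)) ^ n)"
proof -
  let ?V = "lborel_Rn n" and ?P = "Pi\<^sub>M S (\<lambda>_. U)"
  have L: "L > 0" using S by (simp add: L_def card_gt_0_iff)
  have v: "v > 0" using r by (simp add: v_def)
  have ball: "ball_Rn n r \<in> sets ?V" "emeasure ?V (ball_Rn n r) = ennreal v"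
    using emeasure_ball_Rn[OF r] by (auto simp: v_def)
  interpret U: prob_space U
    unfolding U_def by (rule prob_space_uniform_on) (use ball v in auto)
  interpret PU: product_prob_space "\<lambda>_::'i. U" S by unfold_locales
  interpret lb: product_sigma_finite "\<lambda>_::nat. lborel :: real measure" by standard
  interpret V: sigma_finite_measure ?V by (rule lb.sigma_finite) simp
  interpret PV: pair_sigma_finite ?P ?V ..
  have spU: "space U = ball_Rn n r" unfolding U_def by (rule space_uniform_on) (rule ball)
  define h where "h x y = exp (- t * (\<Sum>k<n. (x k)\<^sup>2) - s * (\<Sum>k<n. (x k - y k)\<^sup>2))"
    for x y :: "nat \<Rightarrow> real"
  \<comment> \<open>The factor \<open>sqrt (s * L / pi) ^ n\<close> normalizes the Gaussian integral over \<open>y\<close>.\<close>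
  define K where "K = exp (t * L * r\<^sup>2 + s * c) * sqrt (s * L / pi) ^ n"
  have K: "K \<ge> 0" using L s by (simp add: K_def)
  have coordU: "(\<lambda>x. x k) \<in> borel_measurable U" if "k < n" for k
    unfolding U_def using that by (intro measurable_uniform_on) measurable
  have coordP: "(\<lambda>z. fst z j k) \<in> borel_measurable (?P \<Otimes>\<^sub>M ?V)" if "j \<in> S" "k < n" for j k
    using measurable_compose[OF measurable_compose[OF measurable_fst measurable_component_singleton[OF that(1)]] coordU[OF that(2)]] .
  have coordV: "(\<lambda>z. snd z k) \<in> borel_measurable (?P \<Otimes>\<^sub>M ?V)" if "k < n" for k
    using measurable_compose[OF measurable_snd measurable_component_singleton[of k "{..<n}" "\<lambda>_. lborel :: real measure"]] that by simp
  have hP: "(\<lambda>z. \<Prod>j\<in>S. ennreal (h (fst z j) (snd z))) \<in> borel_measurable (?P \<Otimes>\<^sub>M ?V)"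
  proof (rule borel_measurable_prod_ennreal)
    fix j assume j: "j \<in> S"
    have "(\<lambda>z. - t * (\<Sum>k<n. (fst z j k)\<^sup>2) - s * (\<Sum>k<n. (fst z j k - snd z k)\<^sup>2))
        \<in> borel_measurable (?P \<Otimes>\<^sub>M ?V)"
      by (intro borel_measurable_diff borel_measurable_times borel_measurable_const
          borel_measurable_sum borel_measurable_power) (auto intro: coordP coordV j)
    then have "(\<lambda>z. h (fst z j) (snd z)) \<in> borel_measurable (?P \<Otimes>\<^sub>M ?V)"
      unfolding h_def by (rule measurable_compose[OF _ borel_measurable_exp])
    then show "(\<lambda>z. ennreal (h (fst z j) (snd z))) \<in> borel_measurable (?P \<Otimes>\<^sub>M ?V)"
      by simp
  qed
  have hV: "(\<lambda>x. ennreal (h x y)) \<in> borel_measurable ?V" for y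
    unfolding h_def by measurable
  have hU: "(\<lambda>x. ennreal (h x y)) \<in> borel_measurable U" for y
    unfolding U_def by (rule measurable_uniform_on) (rule hV)
  have ev: "{x \<in> space ?P. inertia n S x \<le> c} \<in> sets ?P"
    using borel_measurable_le[OF measurable_inertia[OF S(1), of n "ball_Rn n r"] borel_measurable_const[of c]]
    unfolding U_def[symmetric] by simp
  have pointwise: "indicator {x \<in> space ?P. inertia n S x \<le> c} x
      \<le> ennreal K * (\<integral>\<^sup>+y. (\<Prod>j\<in>S. ennreal (h (x j) y)) \<partial>?V)" if x: "x \<in> space ?P" for x
  proof (cases "inertia n S x \<le> c")
    case True
    define E where "E = - t * (\<Sum>j\<in>S. \<Sum>k<n. (x j k)\<^sup>2) - s * inertia n S x"
    have "(\<Prod>j\<in>S. ennreal (h (x j) y)) = ennreal (exp E) *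
        ennreal (exp (- (s * L) * (\<Sum>k<n. (y k - (\<Sum>i\<in>S. x i k) / card S)\<^sup>2)))" for y
    proof -
      have "(\<Prod>j\<in>S. h (x j) y) = exp (- t * (\<Sum>j\<in>S. \<Sum>k<n. (x j k)\<^sup>2) - s * (\<Sum>j\<in>S. \<Sum>k<n. (x j k - y k)\<^sup>2))"
        unfolding h_def using S by (simp add: exp_sum[symmetric] sum_subtractf sum_distrib_left sum_negf)
      also have "\<dots> = exp (E + - (s * L) * (\<Sum>k<n. (y k - (\<Sum>i\<in>S. x i k) / card S)\<^sup>2))"
        unfolding sum_sq_dist_eq_inertia[OF S] E_def L_def by (simp add: algebra_simps)
      finally have * : "(\<Prod>j\<in>S. h (x j) y) = exp E *
          exp (- (s * L) * (\<Sum>k<n. (y k - (\<Sum>i\<in>S. x i k) / card S)\<^sup>2))"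
        unfolding exp_add .
      have "(\<Prod>j\<in>S. ennreal (h (x j) y)) = ennreal (\<Prod>j\<in>S. h (x j) y)"
        by (rule prod_ennreal) (simp add: h_def)
      then show ?thesis unfolding * by (simp only: ennreal_mult exp_ge_zero)
    qed
    then have "(\<integral>\<^sup>+y. (\<Prod>j\<in>S. ennreal (h (x j) y)) \<partial>?V) = ennreal (exp E * sqrt (pi / (s * L)) ^ n)"
      using s L nn_integral_gaussian_Rn[OF mult_pos_pos[OF s L], where m = "\<lambda>k. (\<Sum>i\<in>S. x i k) / card S"]
      by (simp add: nn_integral_cmult ennreal_mult)
    moreover have "1 \<le> K * (exp E * sqrt (pi / (s * L)) ^ n)"
    proof -
      have "(\<Sum>k<n. (x j k)\<^sup>2) \<le> r\<^sup>2" if "j \<in> S" for j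
      proof -
        have "x j \<in> ball_Rn n r" using x that spU by (auto simp: space_PiM)
        then have "L2_set (x j) {..<n} \<le> r" by (simp add: ball_Rn_def)
        then have "(L2_set (x j) {..<n})\<^sup>2 \<le> r\<^sup>2" by (intro power_mono) auto
        then show ?thesis by (simp add: L2_set_def sum_nonneg)
      qed
      then have "(\<Sum>j\<in>S. \<Sum>k<n. (x j k)\<^sup>2) \<le> (\<Sum>j\<in>S. r\<^sup>2)" by (rule sum_mono)
      also have "\<dots> = L * r\<^sup>2" by (simp add: L_def)
      finally have "t * (\<Sum>j\<in>S. \<Sum>k<n. (x j k)\<^sup>2) \<le> t * (L * r\<^sup>2)"
        using t by (intro mult_left_mono) auto
      moreover have "s * inertia n S x \<le> s * c" using True s by (intro mult_left_mono) auto
      ultimately have "0 \<le> t * L * r\<^sup>2 + s * c + E" by (simp add: E_def algebra_simps)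
      then have "1 \<le> exp (t * L * r\<^sup>2 + s * c + E)" by simp
      also have "\<dots> = exp (t * L * r\<^sup>2 + s * c) * exp E * (sqrt (s * L / pi) * sqrt (pi / (s * L))) ^ n"
        using s L by (simp add: exp_add flip: real_sqrt_mult)
      also have "\<dots> = K * (exp E * sqrt (pi / (s * L)) ^ n)"
        by (simp add: K_def power_mult_distrib)
      finally show ?thesis .
    qed
    ultimately show ?thesis using K by (simp add: indicator_def True flip: ennreal_mult')
  qed (simp add: indicator_def)
  have inner: "(\<integral>\<^sup>+x. ennreal (h x y) \<partial>U)
      \<le> ennreal (sqrt (pi / (t + s)) ^ n / v * exp (- (t * s / (t + s)) * (\<Sum>k<n. (y k)\<^sup>2)))" for y
  proof -
    have "(\<integral>\<^sup>+x. ennreal (h x y) \<partial>U) \<le> 1 / ennreal v * (\<integral>\<^sup>+x. ennreal (h x y) \<partial>?V)"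
      unfolding U_def ball(2)[symmetric] by (rule nn_integral_uniform_on_le) (rule ball hV)+
    also have "\<dots> = ennreal (1 / v) * ennreal (sqrt (pi / (t + s)) ^ n * exp (- (t * s / (t + s)) * (\<Sum>k<n. (y k)\<^sup>2)))"
      unfolding h_def nn_integral_two_gaussians_Rn[OF t s] using v
      by (simp add: divide_ennreal flip: ennreal_1)
    also have "\<dots> = ennreal (sqrt (pi / (t + s)) ^ n / v * exp (- (t * s / (t + s)) * (\<Sum>k<n. (y k)\<^sup>2)))"
      using v by (simp flip: ennreal_mult')
    finally show ?thesis .
  qed
  have "(\<integral>\<^sup>+x. (\<integral>\<^sup>+y. (\<Prod>j\<in>S. ennreal (h (x j) y)) \<partial>?V) \<partial>?P)
      = (\<integral>\<^sup>+y. (\<integral>\<^sup>+x. (\<Prod>j\<in>S. ennreal (h (x j) y)) \<partial>?P) \<partial>?V)"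
    using PV.Fubini[OF hP] by simp
  also have "\<dots> = (\<integral>\<^sup>+y. (\<integral>\<^sup>+x. ennreal (h x y) \<partial>U) ^ card S \<partial>?V)"
    using S by (intro nn_integral_cong) (subst PU.product_nn_integral_prod, auto intro: hU)
  also have "\<dots> \<le> (\<integral>\<^sup>+y. ennreal (sqrt (pi / (t + s)) ^ n / v * exp (- (t * s / (t + s)) * (\<Sum>k<n. (y k)\<^sup>2))) ^ card S \<partial>?V)"
    by (intro nn_integral_mono power_mono inner) auto
  also have "\<dots> = (\<integral>\<^sup>+y. ennreal ((sqrt (pi / (t + s)) ^ n / v) ^ card S) *
      ennreal (exp (- (L * t * s / (t + s)) * (\<Sum>k<n. (y k - 0)\<^sup>2))) \<partial>?V)"
  proof (rule nn_integral_cong)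
    fix y :: "nat \<Rightarrow> real"
    have split: "ennreal (A * e) ^ card S = ennreal (A ^ card S) * ennreal (e ^ card S)" if "0 \<le> A" "0 \<le> e" for A e :: real
      using that by (simp add: ennreal_mult power_mult_distrib ennreal_power)
    have * : "exp (- (t * s / (t + s)) * (\<Sum>k<n. (y k)\<^sup>2)) ^ card S = exp (- (L * t * s / (t + s)) * (\<Sum>k<n. (y k - 0)\<^sup>2))"
      unfolding L_def exp_of_nat_mult[symmetric] by (simp add: mult.assoc)
    show "ennreal (sqrt (pi / (t + s)) ^ n / v * exp (- (t * s / (t + s)) * (\<Sum>k<n. (y k)\<^sup>2))) ^ card S
      = ennreal ((sqrt (pi / (t + s)) ^ n / v) ^ card S) *
        ennreal (exp (- (L * t * s / (t + s)) * (\<Sum>k<n. (y k - 0)\<^sup>2)))"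
      unfolding *[symmetric] by (rule split) (use v t s in auto)
  qed
  also have "\<dots> = ennreal ((sqrt (pi / (t + s)) ^ n / v) ^ card S) * ennreal (sqrt (pi / (L * t * s / (t + s))) ^ n)"
    using L t s by (subst nn_integral_cmult) (measurable, subst nn_integral_gaussian_Rn, auto)
  finally have double: "(\<integral>\<^sup>+x. (\<integral>\<^sup>+y. (\<Prod>j\<in>S. ennreal (h (x j) y)) \<partial>?V) \<partial>?P)
      \<le> ennreal ((sqrt (pi / (t + s)) ^ n / v) ^ card S) * ennreal (sqrt (pi / (L * t * s / (t + s))) ^ n)" .
  have "emeasure ?P {x \<in> space ?P. inertia n S x \<le> c}
      = (\<integral>\<^sup>+x. indicator {x \<in> space ?P. inertia n S x \<le> c} x \<partial>?P)"
    using ev by simp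
  also have "\<dots> \<le> (\<integral>\<^sup>+x. ennreal K * (\<integral>\<^sup>+y. (\<Prod>j\<in>S. ennreal (h (x j) y)) \<partial>?V) \<partial>?P)"
    by (rule nn_integral_mono) (rule pointwise)
  also have "\<dots> = ennreal K * (\<integral>\<^sup>+x. (\<integral>\<^sup>+y. (\<Prod>j\<in>S. ennreal (h (x j) y)) \<partial>?V) \<partial>?P)"
    using V.borel_measurable_nn_integral_fst[OF hP] by (intro nn_integral_cmult) simp
  also have "\<dots> \<le> ennreal K * (ennreal ((sqrt (pi / (t + s)) ^ n / v) ^ card S) * ennreal (sqrt (pi / (L * t * s / (t + s))) ^ n))"
    by (rule mult_left_mono[OF double]) simp
  also have "\<dots> = ennreal (K * (sqrt (pi / (t + s)) ^ n / v) ^ card S * sqrt (pi * (t + s) / (L * t * s)) ^ n)"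
    using K v t s L by (simp add: mult.assoc flip: ennreal_mult')
  finally show ?thesis unfolding K_def .
qed

text \<open>
  The multipliers are optimized. The extremal Gaussian tuple is exchangeable, with a covariance
  matrix (per coordinate) that has the eigenvalue \<open>l1\<close> on constant vectors and \<open>l2\<close> on their
  complement. Both constraints are tight for it: \<open>l1 + (L - 1) * l2 = L * P\<close> and
  \<open>(L - 1) * l2 = L * N\<close>. The weight should be proportional to its density, whose precision matrix has
  the eigenvalues \<open>2 * t\<close> and \<open>2 * (t + s)\<close>; hence \<open>t = 1 / (2 * l1)\<close> and \<open>t + s = 1 / (2 * l2)\<close>. The
  condition \<open>s > 0\<close> is \<open>l2 < l1\<close>, that is, \<open>N < (L - 1) / L * P\<close>. The base of the \<open>m\<close>-th power equals
  \<open>l1 * l2 ^ (L - 1) / P ^ L\<close>, the determinant of the correlation matrix.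
\<close>

lemma emeasure_low_inertia_exponent:
  fixes S :: "'i set" and m L :: nat and P N :: real
  defines "U \<equiv> uniform_on (lborel_Rn (2 * m)) (ball_Rn (2 * m) (sqrt (real (2 * m) * P)))"
    and "l1 \<equiv> real L * (P - N)" and "l2 \<equiv> real L * N / (real L - 1)"
  assumes "finite S" "card S = L" "L \<ge> 2" "m \<ge> 1" "P > 0" "N > 0" "N < (real L - 1) / real L * P"
  shows "emeasure (Pi\<^sub>M S (\<lambda>_. U))
      {x \<in> space (Pi\<^sub>M S (\<lambda>_. U)). inertia (2 * m) S x \<le> real L * (real (2 * m) * N)}
    \<le> ennreal ((l1 / l2 * (l2 / P) ^ L) ^ m * (exp 1 * real m) ^ L)"
proof -
  have L: "real L > 1" using assms by simp
  have NP: "real L * N < (real L - 1) * P" using assms by (simp add: field_simps)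
  have l2: "l2 > 0" using assms L by (simp add: l2_def)
  have "l2 < P" using NP L by (simp add: l2_def field_simps)
  moreover have "P < l1" using NP by (simp add: l1_def field_simps)
  ultimately have l12: "l2 < l1" "l1 > 0" using assms by auto
  define t s where "t = 1 / (2 * l1)" and "s = 1 / (2 * l2) - 1 / (2 * l1)"
  have t: "t > 0" using l12 by (simp add: t_def)
  have s: "s > 0" using l12 l2 by (simp add: s_def field_simps)
  have ts: "t + s = 1 / (2 * l2)" by (simp add: t_def s_def)
  define r v where "r = sqrt (real (2 * m) * P)" and "v = unit_ball_vol (real (2 * m)) * r ^ (2 * m)"
  have r: "r > 0" "r\<^sup>2 = real (2 * m) * P" using assms by (auto simp: r_def)
  have v: "v > 0" using r by (simp add: v_def)
  have sq: "sqrt a ^ (2 * m) = a ^ m" if "a \<ge> 0" for a using that by (simp add: power_mult)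
  have "t * real L * r\<^sup>2 + s * (real L * (real (2 * m) * N))
      = real (2 * m) * (t * l1 + (t + s) * (real L * N))"
    unfolding r l1_def by (simp add: algebra_simps)
  also have "t * l1 = 1 / 2" using l12 by (simp add: t_def)
  also have "(t + s) * (real L * N) = (real L - 1) / 2"
    unfolding ts l2_def using L assms by (simp add: field_simps)
  also have "real (2 * m) * (1 / 2 + (real L - 1) / 2) = real (m * L)" by (simp add: field_simps)
  finally have expo: "exp (t * real L * r\<^sup>2 + s * (real L * (real (2 * m) * N))) = (exp 1 ^ m) ^ L"
    by (simp flip: exp_of_nat_mult power_mult)
  have quot: "(s * real L / pi) * (pi * (t + s) / (real L * t * s)) = l1 / l2"
  proof -
    have "(s * real L / pi) * (pi * (t + s) / (real L * t * s)) = (t + s) / t"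
      using s t L by (simp add: field_simps)
    then show ?thesis unfolding ts by (simp add: t_def)
  qed
  have "(2 * pi * l2) ^ m / v \<le> (2 * pi * l2) ^ m / ((2 * pi * exp 1 * P) ^ m / (exp 1 * real m))"
    using ball_volume_even_ge[of m P] assms l2 v
    by (intro divide_left_mono mult_pos_pos) (auto simp: v_def r_def)
  also have "\<dots> = (l2 / P) ^ m / exp 1 ^ m * (exp 1 * real m)"
    using \<open>P > 0\<close> \<open>m \<ge> 1\<close> by (simp add: power_mult_distrib power_divide)
  finally have vol: "(2 * pi * l2) ^ m / v \<le> (l2 / P) ^ m / exp 1 ^ m * (exp 1 * real m)" .
  have "S \<noteq> {}" using assms by auto
  note emeasure_low_inertia_le[OF \<open>finite S\<close> this r(1) t s, where n = "2 * m" and c = "real L * (real (2 * m) * N)",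
      folded U_def[folded r_def], folded v_def, unfolded \<open>card S = L\<close>]
  also have "exp (t * real L * r\<^sup>2 + s * (real L * (real (2 * m) * N))) * sqrt (s * real L / pi) ^ (2 * m) *
      (sqrt (pi / (t + s)) ^ (2 * m) / v) ^ L * sqrt (pi * (t + s) / (real L * t * s)) ^ (2 * m)
    = (exp 1 ^ m) ^ L * (l1 / l2) ^ m * ((2 * pi * l2) ^ m / v) ^ L"
  proof -
    have "pi / (t + s) = 2 * pi * l2" by (simp add: ts)
    then show ?thesis
      unfolding expo quot[symmetric] power_mult_distrib[of "s * real L / pi"]
      using s t L l2 by (subst (1 2 3) sq) (auto simp: mult_ac)
  qed
  also have "\<dots> \<le> (exp 1 ^ m) ^ L * (l1 / l2) ^ m * ((l2 / P) ^ m / exp 1 ^ m * (exp 1 * real m)) ^ L"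
    using vol l2 l12 v by (intro mult_left_mono power_mono) auto
  also have "\<dots> = (l1 / l2 * (l2 / P) ^ L) ^ m * (exp 1 * real m) ^ L"
    by (simp add: power_mult_distrib power_divide field_simps flip: power_mult)
  finally show ?thesis by (simp add: ennreal_leI)
qed

section \<open>Random codes with expurgation\<close>

text \<open>
  Expurgation. Among \<open>M\<close> independent samples, the expected number of bad \<open>L\<close>-subsets is at most
  \<open>M ^ L * p < M / 2\<close>, so some outcome has fewer than \<open>M / 2\<close> of them. Deleting one index from each
  destroys them all and leaves at least half of the samples.
\<close>

lemma exists_large_good_subset:
  fixes U :: "'a measure" and Bad :: "nat set \<Rightarrow> (nat \<Rightarrow> 'a) set" and M L :: nat and p :: real
  assumes U: "prob_space U" and "L > 0" and p: "p \<ge> 0"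
    and meas: "\<And>S. S \<subseteq> {..<M} \<Longrightarrow> card S = L \<Longrightarrow> Bad S \<in> sets (Pi\<^sub>M S (\<lambda>_. U))"
    and prob: "\<And>S. S \<subseteq> {..<M} \<Longrightarrow> card S = L \<Longrightarrow> emeasure (Pi\<^sub>M S (\<lambda>_. U)) (Bad S) \<le> ennreal p"
    and small: "real M ^ L * p < real M / 2"
  obtains x I where "x \<in> {..<M} \<rightarrow>\<^sub>E space U" "I \<subseteq> {..<M}" "real (card I) \<ge> real M / 2"
    "\<And>S. S \<subseteq> I \<Longrightarrow> card S = L \<Longrightarrow> restrict x S \<notin> Bad S"
proof -
  interpret U: prob_space U by fact
  interpret product_prob_space "\<lambda>_::nat. U" "{..<M}" by unfold_locales
  let ?\<Omega> = "Pi\<^sub>M {..<M} (\<lambda>_. U)"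
  define \<S> where "\<S> = {S. S \<subseteq> {..<M} \<and> card S = L}"
  have fin\<S>: "finite \<S>" unfolding \<S>_def by (rule finite_subset[of _ "Pow {..<M}"]) auto
  define B where "B x = {S \<in> \<S>. restrict x S \<in> Bad S}" for x
  have "\<exists>x\<in>space ?\<Omega>. real (card (B x)) < real M / 2"
  proof (rule ccontr)
    assume "\<not> ?thesis"
    then have *: "real M / 2 \<le> real (card (B x))" if "x \<in> space ?\<Omega>" for x
      using that by (auto simp: not_less)
    let ?E = "\<lambda>S. prod_emb {..<M} (\<lambda>_. U) S (Bad S)"
    have ind: "ennreal (real (card (B x))) = (\<Sum>S\<in>\<S>. indicator (?E S) x)" if "x \<in> space ?\<Omega>" for x
    proof -
      have "(\<Sum>S\<in>\<S>. indicator (?E S) x :: ennreal) = (\<Sum>S\<in>\<S>. indicator (B x) S)"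
        using that by (intro sum.cong) (auto simp: B_def prod_emb_def indicator_def space_PiM)
      also have "\<dots> = of_nat (card (\<S> \<inter> B x))"
        using fin\<S> by (simp add: indicator_def sum.If_cases)
      also have "\<S> \<inter> B x = B x" by (auto simp: B_def)
      finally show ?thesis by (simp add: ennreal_of_nat_eq_real_of_nat)
    qed
    have "ennreal (real M / 2) = (\<integral>\<^sup>+x. ennreal (real M / 2) \<partial>?\<Omega>)"
      by (simp add: P.emeasure_space_1)
    also have "\<dots> \<le> (\<integral>\<^sup>+x. ennreal (real (card (B x))) \<partial>?\<Omega>)"
      by (intro nn_integral_mono ennreal_leI *)
    also have "\<dots> = (\<integral>\<^sup>+x. (\<Sum>S\<in>\<S>. indicator (?E S) x) \<partial>?\<Omega>)"
      by (intro nn_integral_cong ind)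
    also have "\<dots> = (\<Sum>S\<in>\<S>. emeasure ?\<Omega> (?E S))"
    proof -
      have "?E S \<in> sets ?\<Omega>" if "S \<in> \<S>" for S
        using that meas by (intro measurable_prod_emb) (auto simp: \<S>_def)
      then show ?thesis by (simp add: nn_integral_sum)
    qed
    also have "\<dots> \<le> (\<Sum>S\<in>\<S>. ennreal p)"
    proof (intro sum_mono)
      fix S assume "S \<in> \<S>"
      then show "emeasure ?\<Omega> (?E S) \<le> ennreal p"
        using meas prob by (subst emeasure_prod_emb) (auto simp: \<S>_def)
    qed
    also have "\<dots> = ennreal (real (card \<S>) * p)"
      using p by (simp add: ennreal_mult ennreal_of_nat_eq_real_of_nat)
    also have "\<dots> \<le> ennreal (real M ^ L * p)"
    proof (intro ennreal_leI mult_right_mono p)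
      have "card \<S> = M choose L" unfolding \<S>_def by (subst n_subsets) auto
      also have "\<dots> \<le> M ^ L"
        by (cases "L \<le> M") (auto intro: binomial_le_pow simp: binomial_eq_0)
      finally show "real (card \<S>) \<le> real M ^ L" by (metis of_nat_le_iff of_nat_power)
    qed
    also have "\<dots> < ennreal (real M / 2)"
    proof (rule ennreal_lessI)
      have "0 \<le> real M ^ L * p" using p by simp
      then show "0 < real M / 2" using small by linarith
    qed (rule small)
    finally show False by simp
  qed
  then obtain x where x: "x \<in> space ?\<Omega>" "real (card (B x)) < real M / 2" by blast
  define I where "I = {..<M} - (\<lambda>S. SOME i. i \<in> S) ` B x"
  have "card (B x) \<ge> card ((\<lambda>S. SOME i. i \<in> S) ` B x)"
    using fin\<S> by (intro card_image_le) (auto simp: B_def)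
  then have "card I + card (B x) \<ge> M"
    unfolding I_def using fin\<S> diff_card_le_card_Diff[of "(\<lambda>S. SOME i. i \<in> S) ` B x" "{..<M}"]
    by (auto simp: B_def)
  then have "real (card I) \<ge> real M / 2" using x(2) by linarith
  moreover have "restrict x S \<notin> Bad S" if "S \<subseteq> I" "card S = L" for S
  proof
    assume "restrict x S \<in> Bad S"
    then have "S \<in> B x" using that by (auto simp: B_def \<S>_def I_def)
    moreover have "S \<noteq> {}" using that \<open>L > 0\<close> by (metis card.empty less_irrefl)
    then have "(SOME i. i \<in> S) \<in> S" by (rule some_in_eq[THEN iffD2])
    ultimately show False using that(1) unfolding I_def by blast
  qed
  moreover have "x \<in> {..<M} \<rightarrow>\<^sub>E space U" using x(1) by (simp add: space_PiM)
  moreover have "I \<subseteq> {..<M}" by (auto simp: I_def)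
  ultimately show ?thesis by (rule that[rotated 2])
qed

text \<open>
  Coinciding points are harmless: an \<open>L\<close>-subset of the index set on which \<open>x\<close> is constant would
  have inertia \<open>0\<close>, so passing from indices to points shrinks the code by a factor of at most
  \<open>L - 1\<close>.
\<close>

lemma code_of_high_inertia:
  fixes x :: "'i \<Rightarrow> nat \<Rightarrow> real"
  assumes I: "finite I" "I \<noteq> {}" and L: "L \<ge> 2" and N: "N > 0"
    and ball: "\<And>i. i \<in> I \<Longrightarrow> x i \<in> ball_Rn n (sqrt (real n * P))"
    and high: "\<And>S. S \<subseteq> I \<Longrightarrow> card S = L \<Longrightarrow> inertia n S x > real L * (real n * N)"
  shows "x ` I \<in> list_decodable_codes n P N (L - 1)"
    and "card I \<le> (L - 1) * card (x ` I)"
proof -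
  have "ereal (real n * N) < code_rad2 n L (x ` I)"
  proof -
    let ?\<A> = "{A. A \<subseteq> x ` I \<and> card A = L}"
    have rad: "ereal (real n * N) < ereal (chebyshev_rad2 n A)" if "A \<in> ?\<A>" for A
    proof -
      from that obtain S where S: "S \<subseteq> I" "inj_on x S" "A = x ` S" by (auto simp: subset_image_inj)
      have card: "card S = L" using that S by (simp add: card_image)
      have "real n * N < inertia n S x / card S"
        using high[OF S(1) card] L unfolding card by (simp add: field_simps)
      also have "\<dots> \<le> chebyshev_rad2 n A"
        unfolding S(3) using S I L card
        by (intro inertia_le_chebyshev_rad2) (auto intro: finite_subset)
      finally show ?thesis by simp
    qed
    have "finite ?\<A>" using I by simp
    show ?thesis
    proof (cases "?\<A> = {}")
      case True
      show ?thesis unfolding code_rad2_def True by (simp add: top_ereal_def)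
    next
      case False
      with \<open>finite ?\<A>\<close> show ?thesis
        unfolding code_rad2_def by (subst finite_less_Inf_iff) (use rad in blast)+
    qed
  qed
  then show "x ` I \<in> list_decodable_codes n P N (L - 1)"
    using I ball L by (auto simp: list_decodable_codes_def)
  have fib: "card {i \<in> I. x i = c} \<le> L - 1" for c
  proof (rule ccontr)
    assume "\<not> ?thesis"
    then have "L \<le> card {i \<in> I. x i = c}" by simp
    then obtain S where S: "S \<subseteq> {i \<in> I. x i = c}" "card S = L"
      by (meson obtain_subset_with_card_n)
    have "inertia n S x = inertia n S (\<lambda>_. c)" using S by (intro inertia_cong) auto
    moreover have "inertia n S x > real L * (real n * N)" using S by (intro high) auto
    moreover have "real L * (real n * N) \<ge> 0" using N by simp
    ultimately show False by (simp add: inertia_const)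
  qed
  have "card I = (\<Sum>c\<in>x ` I. card {i \<in> I. x i = c})"
    using sum.image_gen[OF I(1), of "\<lambda>_. 1::nat" x] by simp
  also have "\<dots> \<le> (\<Sum>c\<in>x ` I. L - 1)" by (intro sum_mono fib)
  finally show "card I \<le> (L - 1) * card (x ` I)" by (simp add: mult.commute)
qed

lemma below_plotkin:
  assumes "L \<ge> 2" "P > 0" "N < (real L - 1) / real L * P"
  shows "real L * N < (real L - 1) * P" "N < P"
proof -
  show 1: "real L * N < (real L - 1) * P" using assms by (simp add: field_simps)
  have "real L * N < real L * P" using 1[unfolded left_diff_distrib] assms(2) by linarith
  then show "N < P" using assms(1) by (simp add: mult_less_cancel_left_pos)
qed

lemma exists_code:
  fixes m L M :: nat and P N :: real
  defines "l1 \<equiv> real L * (P - N)" and "l2 \<equiv> real L * N / (real L - 1)"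
  assumes "L \<ge> 2" "m \<ge> 1" "P > 0" "N > 0" "N < (real L - 1) / real L * P"
    and small: "real M ^ L * ((l1 / l2 * (l2 / P) ^ L) ^ m * (exp 1 * real m) ^ L) < real M / 2"
  obtains C where "C \<in> list_decodable_codes (2 * m) P N (L - 1)"
    "real M / 2 \<le> (real L - 1) * real (card C)"
proof -
  let ?n = "2 * m" and ?r = "sqrt (real (2 * m) * P)"
  define U where "U = uniform_on (lborel_Rn ?n) (ball_Rn ?n ?r)"
  have r: "?r > 0" using assms by simp
  note ball = emeasure_ball_Rn[OF r, of ?n]
  define v where "v = unit_ball_vol (real ?n) * ?r ^ ?n"
  have v: "v > 0" unfolding v_def using r by (intro mult_pos_pos zero_less_power) auto
  have U: "prob_space U"
    unfolding U_def by (rule prob_space_uniform_on) (use ball(1) ball(2)[folded v_def] v in auto)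
  have spU: "space U = ball_Rn ?n ?r" unfolding U_def by (rule space_uniform_on) (rule ball)
  define Bad where "Bad S = {x \<in> space (Pi\<^sub>M S (\<lambda>_. U)). inertia ?n S x \<le> real L * (real ?n * N)}"
    for S :: "nat set"
  have "N < P" using below_plotkin[OF assms(3,5,7)] by simp
  then have p: "0 \<le> (l1 / l2 * (l2 / P) ^ L) ^ m * (exp 1 * real m) ^ L"
    using assms by (intro mult_nonneg_nonneg zero_le_power divide_nonneg_nonneg) auto
  obtain x I where xI: "x \<in> {..<M} \<rightarrow>\<^sub>E space U" "I \<subseteq> {..<M}" "real (card I) \<ge> real M / 2"
    "\<And>S. S \<subseteq> I \<Longrightarrow> card S = L \<Longrightarrow> restrict x S \<notin> Bad S"
  proof (rule exists_large_good_subset[OF U _ p _ _ small, of Bad])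
    show "L > 0" using assms by simp
    fix S assume S: "S \<subseteq> {..<M}" "card S = L"
    then have fin: "finite S" using finite_subset by blast
    show "Bad S \<in> sets (Pi\<^sub>M S (\<lambda>_. U))"
      unfolding Bad_def U_def
      by (rule borel_measurable_le[OF measurable_inertia[OF fin] borel_measurable_const])
    show "emeasure (Pi\<^sub>M S (\<lambda>_. U)) (Bad S) \<le> ennreal ((l1 / l2 * (l2 / P) ^ L) ^ m * (exp 1 * real m) ^ L)"
      unfolding Bad_def U_def l1_def l2_def
      by (rule emeasure_low_inertia_exponent) (use assms S fin in auto)
  qed blast
  have finI: "finite I" using xI(2) finite_subset by blast
  have "real M > 0"
  proof -
    have "0 \<le> real M ^ L * ((l1 / l2 * (l2 / P) ^ L) ^ m * (exp 1 * real m) ^ L)" using p by simp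
    then show ?thesis using small by linarith
  qed
  then have I: "I \<noteq> {}" using xI(3) by auto
  have inball: "x i \<in> ball_Rn ?n ?r" if "i \<in> I" for i using xI that spU by auto
  have high: "inertia ?n S x > real L * (real ?n * N)" if S: "S \<subseteq> I" "card S = L" for S
  proof -
    have "restrict x S \<in> space (Pi\<^sub>M S (\<lambda>_. U))"
      using inball S by (auto simp: space_PiM spU)
    then have "inertia ?n S (restrict x S) > real L * (real ?n * N)"
      using xI(4)[OF S] by (simp add: Bad_def not_le)
    also have "inertia ?n S (restrict x S) = inertia ?n S x" by (intro inertia_cong) auto
    finally show ?thesis .
  qed
  note code = code_of_high_inertia[OF finI I \<open>L \<ge> 2\<close> \<open>N > 0\<close> inball high]
  have "real (card I) \<le> real ((L - 1) * card (x ` I))" using code(2) by (rule of_nat_mono)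
  then have "real M / 2 \<le> (real L - 1) * real (card (x ` I))"
    using xI(3) \<open>L \<ge> 2\<close> by (simp add: of_nat_diff)
  then show ?thesis using code(1) that by blast
qed

section \<open>From codes to the capacity\<close>

lemma capacity_ge_of_even:
  assumes "\<forall>\<^sub>F m in sequentially. \<exists>C\<in>list_decodable_codes (2 * m) P N l. y \<le> rate (2 * m) C"
  shows "ereal y \<le> list_decoding_capacity P N l"
proof -
  let ?X = "\<lambda>n. SUP C\<in>list_decodable_codes n P N l. ereal (rate n C)"
  have "ereal y \<le> limsup (?X \<circ> (\<lambda>m. 2 * m))"
  proof (rule le_Limsup)
    show "\<forall>\<^sub>F m in sequentially. ereal y \<le> (?X \<circ> (\<lambda>m. 2 * m)) m"
      using assms by eventually_elim (auto intro: SUP_upper2)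
  qed simp
  also have "\<dots> \<le> limsup ?X"
    by (rule limsup_subseq_mono) (simp add: strict_mono_def)
  finally show ?thesis unfolding list_decoding_capacity_def .
qed

text \<open>
  A one-point code has no \<open>(l + 1)\<close>-subsets, hence infinite radius, and its rate is \<open>0\<close>.
\<close>

lemma capacity_nonneg:
  assumes "P > 0" "l \<ge> 1"
  shows "0 \<le> list_decoding_capacity P N l"
proof -
  have "\<exists>C\<in>list_decodable_codes n P N l. 0 \<le> rate n C" for n
  proof
    let ?C = "{\<lambda>i\<in>{..<n}. 0 :: real}"
    have "card A \<noteq> l + 1" if "A \<subseteq> ?C" for A
      using card_mono[OF _ that] assms(2) by simp
    then have none: "{A. A \<subseteq> ?C \<and> card A = l + 1} = {}" by blast
    have "code_rad2 n (l + 1) ?C = \<infinity>"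
      unfolding code_rad2_def none by (simp add: top_ereal_def)
    moreover have "?C \<subseteq> ball_Rn n (sqrt (real n * P))"
    proof -
      have "L2_set (\<lambda>i\<in>{..<n}. 0) {..<n} = (0 :: real)" by (simp add: L2_set_def)
      then show ?thesis using assms(1) by (simp add: ball_Rn_def Rn_def)
    qed
    ultimately show "?C \<in> list_decodable_codes n P N l" by (simp add: list_decodable_codes_def)
    show "0 \<le> rate n ?C" by (simp add: rate_def)
  qed
  then show ?thesis using capacity_ge_of_even[of P N l 0] by (simp add: zero_ereal_def)
qed

theorem mainTheorem1:
  fixes L :: nat and P N :: real
  assumes "L \<ge> 2" and "P > 0" and "N > 0"
    and "N \<le> (real L - 1) / real L * P"
  shows "list_decoding_capacity P N (L - 1) \<ge>
    ereal (1 / 2 * (ln ((real L - 1) * P / (real L * N))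
                    + 1 / (real L - 1) * ln (P / (real L * (P - N)))))"
proof -
  define l1 l2 where "l1 = real L * (P - N)" and "l2 = real L * N / (real L - 1)"
  define R where "R = 1 / 2 * (ln ((real L - 1) * P / (real L * N)) + 1 / (real L - 1) * ln (P / (real L * (P - N))))"
  have L: "real L > 1" using assms by simp
  have "ereal R \<le> list_decoding_capacity P N (L - 1)"
  proof (cases "R > 0")
    case False
    then have "ereal R \<le> 0" by simp
    also have "0 \<le> list_decoding_capacity P N (L - 1)" by (rule capacity_nonneg) (use assms in auto)
    finally show ?thesis .
  next
    case True
    \<comment> \<open>At the endpoint \<open>N = (L - 1) / L * P\<close> both logarithms vanish.\<close>
    have "N \<noteq> (real L - 1) / real L * P"
    proof
      assume N: "N = (real L - 1) / real L * P"
      have "real L * N = (real L - 1) * P" using L by (simp add: N)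
      then have "R = 0" using L assms(2) by (simp add: R_def right_diff_distrib left_diff_distrib)
      then show False using True by simp
    qed
    then have N: "N < (real L - 1) / real L * P" using assms by simp
    have l1: "l1 > 0" using below_plotkin(2)[OF assms(1,2) N] L by (simp add: l1_def)
    have l2: "l2 > 0" using L assms by (simp add: l2_def)
    have D: "l1 / l2 * (l2 / P) ^ L = exp (- (2 * (real L - 1) * R))"
    proof -
      have "R = 1 / 2 * (ln (P / l2) + 1 / (real L - 1) * ln (P / l1))"
        by (simp add: R_def l1_def l2_def mult.commute)
      then have "2 * (real L - 1) * R = (real L - 1) * ln (P / l2) + ln (P / l1)"
        using L by (simp add: field_simps)
      also have "\<dots> = - (ln (l1 / l2) + real L * ln (l2 / P))"
        using l1 l2 assms by (simp add: ln_div algebra_simps)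
      finally have "exp (- (2 * (real L - 1) * R)) = exp (ln (l1 / l2)) * exp (real L * ln (l2 / P))"
        by (simp add: exp_add)
      then show ?thesis using l1 l2 assms by (simp add: exp_of_nat_mult)
    qed
    have "ereal y \<le> list_decoding_capacity P N (L - 1)" if y: "y < R" for y
    proof -
      define R' where "R' = (max 0 y + R) / 2"
      have R': "0 < R'" "y < R'" "R' < R" using True y by (auto simp: R'_def)
      \<comment> \<open>The loss \<open>R - R'\<close> in the rate turns into exponential decay, which beats the polynomial factor.\<close>
      define a where "a = 2 * (real L - 1) * (R - R')"
      have a: "a > 0" using L R' by (simp add: a_def)
      have "(\<lambda>m. exp (- a * real m) * (exp 1 * real m) ^ L) \<longlonglongrightarrow> 0"
        using a by real_asymp
      then have 1: "\<forall>\<^sub>F m in sequentially. exp (- a * real m) * (exp 1 * real m) ^ L < 1 / 2"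
        by (rule order_tendstoD) simp
      have "(\<lambda>m. R' - ln (4 * (real L - 1)) / (2 * real m)) \<longlonglongrightarrow> R'"
        by real_asymp
      then have 2: "\<forall>\<^sub>F m in sequentially. y < R' - ln (4 * (real L - 1)) / (2 * real m)"
        by (rule order_tendstoD) (rule R')
      show ?thesis
      proof (rule capacity_ge_of_even)
        show "\<forall>\<^sub>F m in sequentially. \<exists>C\<in>list_decodable_codes (2 * m) P N (L - 1). y \<le> rate (2 * m) C"
          using 1 2 eventually_ge_at_top[of 1]
        proof eventually_elim
          case (elim m)
          define E where "E = exp (2 * real m * R')"
          define M where "M = nat \<lfloor>E\<rfloor>"
          have "E \<ge> 1" using R' by (simp add: E_def)
          then have "1 \<le> \<lfloor>E\<rfloor>" by simp
          moreover from this have "real M = of_int \<lfloor>E\<rfloor>" by (simp add: M_def)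
          ultimately have M: "real M \<le> E" "E / 2 \<le> real M" "real M > 0" by linarith+
          have "real M ^ L * ((l1 / l2 * (l2 / P) ^ L) ^ m * (exp 1 * real m) ^ L)
              = real M * (real M ^ (L - 1) * (exp (- (2 * (real L - 1) * R)) ^ m * (exp 1 * real m) ^ L))"
            unfolding D using assms(1) by (cases L) auto
          also have "\<dots> \<le> real M * (E ^ (L - 1) * (exp (- (2 * (real L - 1) * R)) ^ m * (exp 1 * real m) ^ L))"
            using M by (intro mult_left_mono mult_right_mono power_mono) auto
          also have "E ^ (L - 1) * (exp (- (2 * (real L - 1) * R)) ^ m * (exp 1 * real m) ^ L)
              = exp (- a * real m) * (exp 1 * real m) ^ L"
          proof -
            have "E ^ (L - 1) * exp (- (2 * (real L - 1) * R)) ^ m = exp (- a * real m)"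
              unfolding E_def exp_of_nat_mult[symmetric] exp_add[symmetric] a_def
              using assms(1) by (simp add: of_nat_diff algebra_simps)
            then show ?thesis by (simp only: mult.assoc[symmetric])
          qed
          also have "real M * \<dots> < real M * (1 / 2)"
            using elim M by (intro mult_strict_left_mono) auto
          finally have small: "real M ^ L * ((l1 / l2 * (l2 / P) ^ L) ^ m * (exp 1 * real m) ^ L) < real M / 2"
            by simp
          obtain C where C: "C \<in> list_decodable_codes (2 * m) P N (L - 1)"
            "real M / 2 \<le> (real L - 1) * real (card C)"
            using exists_code[OF assms(1) _ assms(2,3) N small[unfolded l1_def l2_def]] elim by auto
          have "E / (4 * (real L - 1)) \<le> real (card C)"
            using C(2) M(2) L by (simp add: field_simps)
          moreover have "E / (4 * (real L - 1)) > 0" using L by (simp add: E_def)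
          ultimately have "ln (E / (4 * (real L - 1))) \<le> ln (real (card C))"
            by (intro ln_mono) auto
          moreover have "ln (E / (4 * (real L - 1))) = 2 * real m * R' - ln (4 * (real L - 1))"
            using L by (simp add: E_def ln_div)
          ultimately have "(2 * real m * R' - ln (4 * (real L - 1))) / (2 * real m) \<le> rate (2 * m) C"
            unfolding rate_def by (simp add: divide_right_mono)
          then have "R' - ln (4 * (real L - 1)) / (2 * real m) \<le> rate (2 * m) C"
            using elim by (simp add: diff_divide_distrib)
          then show ?case using elim C(1) by (intro bexI[of _ C]) auto
        qed
      qed
    qed
    note below = this
    show ?thesis
    proof (rule dense_le)
      fix u assume "u < ereal R"
      then show "u \<le> list_decoding_capacity P N (L - 1)" using below by (cases u) auto
    qed
  qed
  then show ?thesis unfolding R_def .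
qed

end
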